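(* (1) For every finite set $V$ and every relation $\mathcal{L}\subseteq\mathcal{T}(V)$, if $\mathcal{L}$ is a semigraphoid closed under intersection, then $\mathcal{L}$ is closed under symmetry, localizability and the pseudographoid rule. The converse does not hold: there exist a finite set $V$ and a relation $\mathcal{L}\subseteq\mathcal{T}(V)$ closed under symmetry, localizability and the pseudographoid rule which is not a semigraphoid closed under intersection. (2) For every finite set $V$ and every relation $\mathcal{L}\subseteq\mathcal{T}(V)$, if $\mathcal{L}$ is a semigraphoid closed under composition, then $\mathcal{L}$ is closed under symmetry, localizability and the reverse pseudographoid rule. The converse does not hold: there exist a finite set $V$ and a relation $\mathcal{L}\subseteq\mathcal{T}(V)$ closed under symmetry, localizability and the reverse pseudographoid rule which is not a semigraphoid closed under composition.
   Context: For a finite set $V$, $\mathcal{T}(V)$ is the set of all triples $(A,B|C)$ with $A,B,C\subseteq V$ pairwise disjoint and $A,B$ nonempty ($C$ may be empty). A relation is a subset of $\mathcal{T}(V)$. Juxtaposition denotes union ($BC=B\cup C$), lowercase letters denote elements of $V$ identified with singletons, and $ab=\{a,b\}$. Below $A,B,C,S\subseteq V$ are pairwise disjoint with $A,B,C$ nonempty, and $a,b,c$ are distinct elements of $V$ outside $S$. Each rule is required for all such choices. Symmetry: $(A,B|S)\in\mathcal{L}\iff(B,A|S)\in\mathcal{L}$. Decomposition: $(A,BC|S)\in\mathcal{L}\Rightarrow(A,B|S)\in\mathcal{L}$. Weak union: $(A,BC|S)\in\mathcal{L}\Rightarrow(A,B|SC)\in\mathcal{L}$. Contraction: $(A,B|S),(A,C|BS)\in\mathcal{L}\Rightarrow(A,BC|S)\in\mathcal{L}$.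 A semigraphoid is a relation closed under these four rules. Intersection: $(A,B|SC),(A,C|SB)\in\mathcal{L}\Rightarrow(A,BC|S)\in\mathcal{L}$. Composition: $(A,B|S),(A,C|S)\in\mathcal{L}\Rightarrow(A,BC|S)\in\mathcal{L}$. Localizability: $(A,B|S)\in\mathcal{L}$ if and only if $(a,b|S')\in\mathcal{L}$ for all $a\in A$, $b\in B$ and all $S'$ with $S\subseteq S'\subseteq SAB\setminus ab$. Pseudographoid rule: $(a,b|Sc),(a,c|Sb)\in\mathcal{L}\Rightarrow(a,b|S),(a,c|S)\in\mathcal{L}$. Reverse pseudographoid rule: $(a,b|S),(a,c|S)\in\mathcal{L}\Rightarrow(a,b|Sc),(a,c|Sb)\in\mathcal{L}$. *)

theory Defs
  imports Main
begin

text \<open>A triple \<open>(A, B | C)\<close> is encoded as the nested pair \<open>(A, B, C)\<close>.\<close>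

definition triples :: "'a set \<Rightarrow> ('a set \<times> 'a set \<times> 'a set) set" where
  "triples V = {(A, B, C). A \<subseteq> V \<and> B \<subseteq> V \<and> C \<subseteq> V \<and>
     A \<inter> B = {} \<and> A \<inter> C = {} \<and> B \<inter> C = {} \<and> A \<noteq> {} \<and> B \<noteq> {}}"

text \<open>The choices over which the rules quantify: \<open>triples V\<close> for rules that mention only
  \<open>A, B, S\<close>, and the following two sets for rules that mention \<open>A, B, C, S\<close> or \<open>a, b, c, S\<close>.\<close>

definition set_choices :: "'a set \<Rightarrow> ('a set \<times> 'a set \<times> 'a set \<times> 'a set) set" where
  "set_choices V = {(A, B, C, S). A \<subseteq> V \<and> B \<subseteq> V \<and> C \<subseteq> V \<and> S \<subseteq> V \<and>
     A \<inter> B = {} \<and> A \<inter> C = {} \<and> A \<inter> S = {} \<and> B \<inter> C = {} \<and> B \<inter> S = {} \<and> C \<inter> S = {} \<and>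
     A \<noteq> {} \<and> B \<noteq> {} \<and> C \<noteq> {}}"

definition point_choices :: "'a set \<Rightarrow> ('a \<times> 'a \<times> 'a \<times> 'a set) set" where
  "point_choices V = {(a, b, c, S). S \<subseteq> V \<and> a \<in> V - S \<and> b \<in> V - S \<and> c \<in> V - S \<and>
     a \<noteq> b \<and> a \<noteq> c \<and> b \<noteq> c}"

definition symmetry :: "'a set \<Rightarrow> ('a set \<times> 'a set \<times> 'a set) set \<Rightarrow> bool" where
  "symmetry V L \<longleftrightarrow> (\<forall>(A, B, S) \<in> triples V. (A, B, S) \<in> L \<longleftrightarrow> (B, A, S) \<in> L)"

definition decomposition :: "'a set \<Rightarrow> ('a set \<times> 'a set \<times> 'a set) set \<Rightarrow> bool" where
  "decomposition V L \<longleftrightarrow> (\<forall>(A, B, C, S) \<in> set_choices V.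
     (A, B \<union> C, S) \<in> L \<longrightarrow> (A, B, S) \<in> L)"

definition weak_union :: "'a set \<Rightarrow> ('a set \<times> 'a set \<times> 'a set) set \<Rightarrow> bool" where
  "weak_union V L \<longleftrightarrow> (\<forall>(A, B, C, S) \<in> set_choices V.
     (A, B \<union> C, S) \<in> L \<longrightarrow> (A, B, S \<union> C) \<in> L)"

definition contraction :: "'a set \<Rightarrow> ('a set \<times> 'a set \<times> 'a set) set \<Rightarrow> bool" where
  "contraction V L \<longleftrightarrow> (\<forall>(A, B, C, S) \<in> set_choices V.
     (A, B, S) \<in> L \<and> (A, C, B \<union> S) \<in> L \<longrightarrow> (A, B \<union> C, S) \<in> L)"

definition semigraphoid :: "'a set \<Rightarrow> ('a set \<times> 'a set \<times> 'a set) set \<Rightarrow> bool" where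
  "semigraphoid V L \<longleftrightarrow> L \<subseteq> triples V \<and>
     symmetry V L \<and> decomposition V L \<and> weak_union V L \<and> contraction V L"

definition intersection :: "'a set \<Rightarrow> ('a set \<times> 'a set \<times> 'a set) set \<Rightarrow> bool" where
  "intersection V L \<longleftrightarrow> (\<forall>(A, B, C, S) \<in> set_choices V.
     (A, B, S \<union> C) \<in> L \<and> (A, C, S \<union> B) \<in> L \<longrightarrow> (A, B \<union> C, S) \<in> L)"

definition composition :: "'a set \<Rightarrow> ('a set \<times> 'a set \<times> 'a set) set \<Rightarrow> bool" where
  "composition V L \<longleftrightarrow> (\<forall>(A, B, C, S) \<in> set_choices V.
     (A, B, S) \<in> L \<and> (A, C, S) \<in> L \<longrightarrow> (A, B \<union> C, S) \<in> L)"

definition localizability :: "'a set \<Rightarrow> ('a set \<times> 'a set \<times> 'a set) set \<Rightarrow> bool" where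
  "localizability V L \<longleftrightarrow> (\<forall>(A, B, S) \<in> triples V. (A, B, S) \<in> L \<longleftrightarrow>
     (\<forall>a \<in> A. \<forall>b \<in> B. \<forall>S'. S \<subseteq> S' \<and> S' \<subseteq> (S \<union> A \<union> B) - {a, b} \<longrightarrow> ({a}, {b}, S') \<in> L))"

definition pseudographoid_rule :: "'a set \<Rightarrow> ('a set \<times> 'a set \<times> 'a set) set \<Rightarrow> bool" where
  "pseudographoid_rule V L \<longleftrightarrow> (\<forall>(a, b, c, S) \<in> point_choices V.
     ({a}, {b}, S \<union> {c}) \<in> L \<and> ({a}, {c}, S \<union> {b}) \<in> L \<longrightarrow>
     ({a}, {b}, S) \<in> L \<and> ({a}, {c}, S) \<in> L)"

definition reverse_pseudographoid_rule :: "'a set \<Rightarrow> ('a set \<times> 'a set \<times> 'a set) set \<Rightarrow> bool" where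
  "reverse_pseudographoid_rule V L \<longleftrightarrow> (\<forall>(a, b, c, S) \<in> point_choices V.
     ({a}, {b}, S) \<in> L \<and> ({a}, {c}, S) \<in> L \<longrightarrow>
     ({a}, {b}, S \<union> {c}) \<in> L \<and> ({a}, {c}, S \<union> {b}) \<in> L)"

end

theory Submission imports Defs begin

text \<open>In a semigraphoid, a statement \<open>(A, B | S)\<close> is determined by its elementary consequences
  \<open>(a, b | S')\<close>. Downwards, decomposition forgets elements of one side and weak union moves them
  into the condition, so every \<open>S'\<close> between \<open>S\<close> and \<open>S \<union> A \<union> B - {a, b}\<close> can be reached
  (\<open>semigraphoid_restrict\<close>). Upwards, contraction reassembles one side element by element, the
  condition growing by the elements already assembled (\<open>semigraphoid_assemble\<close>); this is done
  for \<open>A\<close> and then for \<open>B\<close>. The two directions together are localizability.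
  The point rules come from intersection and composition for three single points: these assemble
  \<open>(a, bc | S)\<close> from the two premises, and the conclusions are restrictions of that statement.

  For both converses the same relation on three points serves: the symmetric closure of
  \<open>(a, b | \<emptyset>)\<close> and \<open>(a, c | b)\<close>, with \<open>a, b, c\<close> being \<open>0, 1, 2\<close>. It violates contraction. No pair of points occurs in it
  under two different conditions, whereas a statement with a non-singleton side would require this;
  so localizability forces nothing beyond the elementary statements. Both point rules hold
  vacuously: only \<open>a\<close> occurs together with two other points, and the conditions \<open>\<emptyset>\<close> and \<open>b\<close>
  of the two statements are neither those of the pseudographoid rule, which would be \<open>S c\<close> and
  \<open>S b\<close>, nor equal, as the reverse rule requires.\<close>

lemma semigraphoid_sym:
  assumes "semigraphoid V L" "(A, B, S) \<in> L"
  shows "(B, A, S) \<in> L"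
proof -
  have "(A, B, S) \<in> triples V" "symmetry V L"
    using assms by (auto simp: semigraphoid_def)
  then show ?thesis using assms(2) unfolding symmetry_def by fast
qed

text \<open>Decomposition and weak union speak of two nonempty parts. Splitting the discarded part
  \<open>B - B'\<close> into what is forgotten and what joins the condition, either of which may be
  empty, combines them into one rule.\<close>

lemma semigraphoid_restrict:
  assumes L: "semigraphoid V L" and in_L: "(A, B, S) \<in> L"
    and B': "B' \<subseteq> B" "B' \<noteq> {}" and S': "S \<subseteq> S'" "S' \<subseteq> S \<union> (B - B')"
  shows "(A, B', S') \<in> L"
proof -
  have T: "(A, B, S) \<in> triples V" using L in_L by (auto simp: semigraphoid_def)
  define C where "C = S' - S"
  define D where "D = B - (B' \<union> C)"
  have parts: "B = (B' \<union> C) \<union> D" "S' = S \<union> C" "(B' \<union> C) \<inter> D = {}"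
    using B' S' by (auto simp: C_def D_def)
  have "B' \<inter> C = {}" using S' by (auto simp: C_def)
  have kept: "(A, B' \<union> C, S) \<in> L"
  proof (cases "D = {}")
    case True
    then show ?thesis using in_L parts by simp
  next
    case False
    then have "(A, B' \<union> C, D, S) \<in> set_choices V"
      using T parts B' by (auto simp: triples_def set_choices_def)
    then show ?thesis
      using L in_L parts unfolding semigraphoid_def decomposition_def by fast
  qed
  show ?thesis
  proof (cases "C = {}")
    case True
    then show ?thesis using kept parts by simp
  next
    case False
    then have "(A, B', C, S) \<in> set_choices V"
      using T parts B' \<open>B' \<inter> C = {}\<close> by (auto simp: triples_def set_choices_def)
    then show ?thesis
      using L kept parts unfolding semigraphoid_def weak_union_def by fast
  qed
qed

text \<open>Converse to restriction to single points: with \<open>B = {b\<^sub>1, \<dots>, b\<^sub>n}\<close>, contraction chains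
  the statements \<open>(A, b\<^sub>i | S b\<^sub>1 \<dots> b\<^sub>i\<^sub>-\<^sub>1)\<close>. The hypothesis asks for all conditions
  in between, so that it does not depend on an enumeration of \<open>B\<close>.\<close>

lemma semigraphoid_assemble:
  assumes L: "semigraphoid V L" and "finite B" "(A, B, S) \<in> triples V"
    and "\<And>b S'. b \<in> B \<Longrightarrow> S \<subseteq> S' \<Longrightarrow> S' \<subseteq> S \<union> B - {b} \<Longrightarrow> (A, {b}, S') \<in> L"
  shows "(A, B, S) \<in> L"
proof -
  have "B \<noteq> {}" using assms(3) by (auto simp: triples_def)
  with \<open>finite B\<close> show ?thesis using assms(3,4)
  proof (induction B rule: finite_ne_induct)
    case (singleton b)
    then show ?case by (auto simp: triples_def)
  next
    case (insert b F)
    have "(A, F, S) \<in> triples V" using insert by (auto simp: triples_def)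
    moreover have "(A, {b'}, S') \<in> L" if "b' \<in> F" "S \<subseteq> S'" "S' \<subseteq> S \<union> F - {b'}" for b' S'
      using that insert.prems(2)[of b' S'] by blast
    ultimately have "(A, F, S) \<in> L" by (rule insert.IH)
    moreover have "(A, {b}, F \<union> S) \<in> L"
      using insert.hyps insert.prems(1) by (intro insert.prems(2)) (auto simp: triples_def)
    moreover have "(A, F, {b}, S) \<in> set_choices V"
      using insert.hyps insert.prems(1) by (auto simp: triples_def set_choices_def)
    ultimately have "(A, F \<union> {b}, S) \<in> L"
      using L unfolding semigraphoid_def contraction_def by fast
    then show ?case by simp
  qed
qed

lemma semigraphoid_localizability:
  assumes "finite V" and L: "semigraphoid V L"
  shows "localizability V L"
  unfolding localizability_def
proof (clarify, intro iffI ballI allI impI, goal_cases)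
  case (1 A B S a b S')
  have disj: "A \<inter> B = {}" "A \<inter> S = {}" "B \<inter> S = {}"
    using 1(1) by (auto simp: triples_def)
  have "(A, {b}, S \<union> (S' \<inter> B)) \<in> L"
    by (rule semigraphoid_restrict[OF L 1(2)]) (use 1 in auto)
  then have "({b}, A, S \<union> (S' \<inter> B)) \<in> L" by (rule semigraphoid_sym[OF L])
  then have "({b}, {a}, S') \<in> L"
    by (rule semigraphoid_restrict[OF L]) (use 1 disj in auto)
  then show ?case by (rule semigraphoid_sym[OF L])
next
  case (2 A B S)
  have fin: "finite A" "finite B"
    using 2(1) \<open>finite V\<close> by (auto simp: triples_def intro: finite_subset)
  have "(A, {b}, T) \<in> L" if b: "b \<in> B" "S \<subseteq> T" "T \<subseteq> S \<union> B - {b}" for b T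
  proof -
    have "({b}, A, T) \<in> L"
    proof (rule semigraphoid_assemble[OF L \<open>finite A\<close>])
      show "({b}, A, T) \<in> triples V"
        using 2(1) b by (auto simp: triples_def)
      fix a S' assume a: "a \<in> A" "T \<subseteq> S'" "S' \<subseteq> T \<union> A - {a}"
      have "b \<notin> A" using 2(1) b(1) by (auto simp: triples_def)
      then have "S \<subseteq> S' \<and> S' \<subseteq> S \<union> A \<union> B - {a, b}"
        using a b by auto
      then have "({a}, {b}, S') \<in> L" using 2(2) a(1) b(1) by blast
      then show "({b}, {a}, S') \<in> L" by (rule semigraphoid_sym[OF L])
    qed
    then show ?thesis by (rule semigraphoid_sym[OF L])
  qed
  then show ?case by (rule semigraphoid_assemble[OF L \<open>finite B\<close> 2(1)])
qed

lemma point_choices_sets: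
  "(a, b, c, S) \<in> point_choices V \<Longrightarrow> ({a}, {b}, {c}, S) \<in> set_choices V"
  by (auto simp: point_choices_def set_choices_def)

lemma intersection_pseudographoid_rule:
  assumes L: "semigraphoid V L" and int: "intersection V L"
  shows "pseudographoid_rule V L"
  unfolding pseudographoid_rule_def
proof (clarify, goal_cases)
  case (1 a b c S)
  have joint: "({a}, {b} \<union> {c}, S) \<in> L"
    using int 1(2,3) point_choices_sets[OF 1(1)] unfolding intersection_def by fast
  show ?case
    by (intro conjI; rule semigraphoid_restrict[OF L joint]; simp)
qed

lemma composition_reverse_pseudographoid_rule:
  assumes L: "semigraphoid V L" and comp: "composition V L"
  shows "reverse_pseudographoid_rule V L"
  unfolding reverse_pseudographoid_rule_def
proof (clarify, goal_cases)
  case (1 a b c S)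
  have joint: "({a}, {b} \<union> {c}, S) \<in> L"
    using comp 1(2,3) point_choices_sets[OF 1(1)] unfolding composition_def by fast
  have "b \<noteq> c" using 1(1) by (auto simp: point_choices_def)
  then show ?case
    by (intro conjI; intro semigraphoid_restrict[OF L joint]; auto)
qed

text \<open>If \<open>A \<union> B\<close> has more than two elements, then localizability of \<open>(A, B | S)\<close> concerns
  some pair \<open>a, b\<close> under both the smallest condition \<open>S\<close> and the different largest condition
  \<open>S \<union> A \<union> B - {a, b}\<close>.\<close>

lemma localizability_if_unique_condition:
  assumes single: "\<And>A B S. (A, B, S) \<in> L \<Longrightarrow> \<exists>a b. A = {a} \<and> B = {b}"
    and unique: "\<And>A B S S'. (A, B, S) \<in> L \<Longrightarrow> (A, B, S') \<in> L \<Longrightarrow> S = S'"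
  shows "localizability V L"
  unfolding localizability_def
proof (clarify, intro iffI ballI allI impI, goal_cases)
  case (1 A B S a b S')
  then have "A = {a}" "B = {b}" using single[OF 1(2)] by auto
  moreover from this have "S' = S" using 1(5) by auto
  ultimately show ?case using 1(2) by simp
next
  case (2 A B S)
  then obtain a b where ab: "a \<in> A" "b \<in> B" by (auto simp: triples_def)
  have disj: "A \<inter> B = {}" "A \<inter> S = {}" "B \<inter> S = {}"
    using 2(1) by (auto simp: triples_def)
  have smallest: "({a}, {b}, S) \<in> L"
    using 2(2)[rule_format, OF ab, of S] ab disj by auto
  moreover have "({a}, {b}, S \<union> A \<union> B - {a, b}) \<in> L"
    using 2(2)[rule_format, OF ab, of "S \<union> A \<union> B - {a, b}"] ab disj by auto
  ultimately have "S = S \<union> A \<union> B - {a, b}" by (rule unique)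
  then have "A = {a}" "B = {b}" using ab disj by auto
  then show ?case using smallest by simp
qed

definition non_contractible :: "(nat set \<times> nat set \<times> nat set) set" where
  "non_contractible = {({0}, {1}, {}), ({1}, {0}, {}), ({0}, {2}, {1}), ({2}, {0}, {1})}"

lemma non_contractible_triples: "non_contractible \<subseteq> triples {0, 1, 2}"
  by (auto simp: non_contractible_def triples_def)

lemma non_contractible_symmetry: "symmetry V non_contractible"
  by (auto simp: non_contractible_def symmetry_def)

lemma non_contractible_localizability: "localizability V non_contractible"
  by (rule localizability_if_unique_condition) (auto simp: non_contractible_def)

lemma non_contractible_pseudographoid_rule: "pseudographoid_rule V non_contractible"
  by (auto simp: non_contractible_def pseudographoid_rule_def point_choices_def)

lemma non_contractible_reverse_pseudographoid_rule:
  "reverse_pseudographoid_rule V non_contractible"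
  by (auto simp: non_contractible_def reverse_pseudographoid_rule_def point_choices_def)

lemma non_contractible_not_semigraphoid: "\<not> semigraphoid {0, 1, 2} non_contractible"
proof
  assume "semigraphoid {0, 1, 2} non_contractible"
  then have "contraction {0, 1, 2} non_contractible" by (simp add: semigraphoid_def)
  moreover have "({0}, {1}, {2}, {}) \<in> set_choices {0, 1, 2 :: nat}"
    by (auto simp: set_choices_def)
  moreover have "({0}, {1}, {}) \<in> non_contractible" "({0}, {2}, {1} \<union> {}) \<in> non_contractible"
    by (auto simp: non_contractible_def)
  ultimately have "({0}, {1} \<union> {2}, {}) \<in> non_contractible"
    unfolding contraction_def by fast
  then show False by (auto simp: non_contractible_def)
qed

theorem lemma5p4:
  shows
    "((\<forall>(V :: 'a set) L. finite V \<and> L \<subseteq> triples V \<longrightarrow>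
         semigraphoid V L \<and> intersection V L \<longrightarrow>
         symmetry V L \<and> localizability V L \<and> pseudographoid_rule V L) \<and>
      (\<exists>(V :: nat set) L. finite V \<and> L \<subseteq> triples V \<and>
         symmetry V L \<and> localizability V L \<and> pseudographoid_rule V L \<and>
         \<not> (semigraphoid V L \<and> intersection V L))) \<and>
     ((\<forall>(V :: 'a set) L. finite V \<and> L \<subseteq> triples V \<longrightarrow>
         semigraphoid V L \<and> composition V L \<longrightarrow>
         symmetry V L \<and> localizability V L \<and> reverse_pseudographoid_rule V L) \<and>
      (\<exists>(V :: nat set) L. finite V \<and> L \<subseteq> triples V \<and>
         symmetry V L \<and> localizability V L \<and> reverse_pseudographoid_rule V L \<and>
         \<not> (semigraphoid V L \<and> composition V L)))"
proof (intro conjI allI impI, goal_cases)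
  case (1 V L)
  then show ?case by (simp add: semigraphoid_def)
next
  case (2 V L)
  then show ?case by (simp add: semigraphoid_localizability)
next
  case (3 V L)
  then show ?case by (simp add: intersection_pseudographoid_rule)
next
  case 4
  show ?case
    using non_contractible_triples non_contractible_symmetry non_contractible_localizability
      non_contractible_pseudographoid_rule non_contractible_not_semigraphoid
    by (intro exI[of _ "{0, 1, 2}"] exI[of _ non_contractible]) simp
next
  case (5 V L)
  then show ?case by (simp add: semigraphoid_def)
next
  case (6 V L)
  then show ?case by (simp add: semigraphoid_localizability)
next
  case (7 V L)
  then show ?case by (simp add: composition_reverse_pseudographoid_rule)
next
  case 8
  show ?case
    using non_contractible_triples non_contractible_symmetry non_contractible_localizability
      non_contractible_reverse_pseudographoid_rule non_contractible_not_semigraphoid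
    by (intro exI[of _ "{0, 1, 2}"] exI[of _ non_contractible]) simp
qed

end
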